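(* Let $\mathcal{T}$ be a rooted prefix tree with finite set $V$ of cacheable chunks, let $\mathcal{M}=\{1,\ldots,M\}$ be a set of workers with budgets $k_m$, demands $\Lambda_m(b)\ge0$, recomputation costs $w_m(b)\ge0$, and source-dependent fetch costs $f_{m\leftarrow h}(b)$ for $m\neq h$ in $\mathcal{M}$ and $b\in V$. Define $$q_{m\leftarrow h}(b)=\begin{cases} w_m(b), & h=m,\\ [w_m(b)-f_{m\leftarrow h}(b)]_+, & h\ne m,\end{cases}$$ and, for a placement $\boldsymbol{T}=(T_1,\ldots,T_M)$ with holder sets $H_b(\boldsymbol{T})=\{h: b\in T_h\}$, $$F_{\rm pair}(\boldsymbol{T})=\sum_{b\in V}\sum_{m=1}^{M}\Lambda_m(b)\max_{h\in H_b(\boldsymbol{T})}q_{m\leftarrow h}(b),$$ where the maximum over the empty set is $0$. Then $F_{\rm pair}$, as a set function on subsets of the ground set $\mathcal{E}=\{(m,b):m\in\mathcal{M},\,b\in V\}$, is nonnegative, monotone, and submodular. Moreover, fix a worker $h$ and the placements $T_\ell$ of all workers $\ell\neq h$. Then the exact marginal placement problem for worker $h$, namely maximizing over all parent-closed $T_h\subseteq V$ with $|T_h|\le k_h$ the gain in $F_{\rm pair}$ obtained by replacing the empty set by $T_h$ at worker $h$ while keeping the other placements fixed, is a parent-closed tree selection problem with additive node profits: for every such $T_h$ the gain equals $\sum_{b\in T_h}p_h(b)$, where $$p_h(b)=\sum_{m}\Lambda_m(b)\,[q_{m\leftarrow h}(b)-v_m^{(-h)}(b)]_+$$ and $v_m^{(-h)}(b)=\max\{q_{m\leftarrow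 \ell}(b): \ell\neq h,\ b\in T_\ell\}$ is requester $m$'s best saving on $b$ among the current holders other than $h$ (equal to $0$ if there is no such holder).
   Context: Notation: $[x]_+=\max\{x,0\}$. The costs $f_{m\leftarrow h}(b)$ are arbitrary real numbers; $f_{m\leftarrow h}(b)$ is the cost for requester $m$ to fetch chunk $b$ from holder $h$. The tree $\mathcal{T}$ may have an additional no-cost dummy root (not in $V$, always present, not consuming budget). A set $T\subseteq V$ is parent-closed if whenever a node is in $T$, every ancestor of it in $V$ is in $T$. A subset $S\subseteq\mathcal{E}$ is identified with the tuple $(T_1,\ldots,T_M)$, $T_m=\{b:(m,b)\in S\}$, so that $F_{\rm pair}(S)$ is defined for every $S\subseteq\mathcal{E}$. Monotone means $F(A)\le F(B)$ for $A\subseteq B$; submodular means $F(A\cup\{e\})-F(A)\ge F(B\cup\{e\})-F(B)$ for $A\subseteq B$ and $e\notin B$. *)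

theory Defs
  imports Complex_Main
begin

text \<open>A rooted tree with node set \<open>N\<close> and root \<open>r\<close> is given by the parent function \<open>par\<close>,
  whose value at \<open>r\<close> (and outside \<open>N\<close>) is irrelevant. Since parents are unique and the root has
  no outgoing edge, reachability of the root from every node already excludes cycles.\<close>

definition parent_rel :: "'b set \<Rightarrow> 'b \<Rightarrow> ('b \<Rightarrow> 'b) \<Rightarrow> ('b \<times> 'b) set" where
  "parent_rel N r par = {(x, par x) | x. x \<in> N - {r}}"

definition rooted_tree :: "'b set \<Rightarrow> 'b \<Rightarrow> ('b \<Rightarrow> 'b) \<Rightarrow> bool" where
  "rooted_tree N r par \<longleftrightarrow>
     r \<in> N \<and> (\<forall>x\<in>N - {r}. par x \<in> N) \<and> (\<forall>x\<in>N. (x, r) \<in> (parent_rel N r par)\<^sup>*)"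

text \<open>The cacheable chunks \<open>V\<close> are either all nodes, or all nodes except a no-cost dummy root.\<close>

definition cacheable_tree :: "'b set \<Rightarrow> 'b \<Rightarrow> ('b \<Rightarrow> 'b) \<Rightarrow> 'b set \<Rightarrow> bool" where
  "cacheable_tree N r par V \<longleftrightarrow>
     rooted_tree N r par \<and> (V = N \<or> V = N - {r}) \<and> finite V"

definition ancestor :: "'b set \<Rightarrow> 'b \<Rightarrow> ('b \<Rightarrow> 'b) \<Rightarrow> 'b \<Rightarrow> 'b \<Rightarrow> bool" where
  "ancestor N r par a x \<longleftrightarrow> (x, a) \<in> (parent_rel N r par)\<^sup>+"

definition parent_closed :: "'b set \<Rightarrow> 'b \<Rightarrow> ('b \<Rightarrow> 'b) \<Rightarrow> 'b set \<Rightarrow> 'b set \<Rightarrow> bool" where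
  "parent_closed N r par V X \<longleftrightarrow>
     X \<subseteq> V \<and> (\<forall>x\<in>X. \<forall>a\<in>V. ancestor N r par a x \<longrightarrow> a \<in> X)"

definition feasible :: "'b set \<Rightarrow> 'b \<Rightarrow> ('b \<Rightarrow> 'b) \<Rightarrow> 'b set \<Rightarrow> nat \<Rightarrow> 'b set \<Rightarrow> bool" where
  "feasible N r par V K X \<longleftrightarrow> parent_closed N r par V X \<and> card X \<le> K"

definition pos_part :: "real \<Rightarrow> real" where
  "pos_part x = max x 0"

definition max_or_0 :: "real set \<Rightarrow> real" where
  "max_or_0 A = (if A = {} then 0 else Max A)"

text \<open>\<open>f m h b\<close> is the cost for requester \<open>m\<close> to fetch chunk \<open>b\<close> from holder \<open>h\<close>;
  it is only used for \<open>m \<noteq> h\<close>.\<close>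

definition saving ::
  "(nat \<Rightarrow> 'b \<Rightarrow> real) \<Rightarrow> (nat \<Rightarrow> nat \<Rightarrow> 'b \<Rightarrow> real) \<Rightarrow> nat \<Rightarrow> nat \<Rightarrow> 'b \<Rightarrow> real" where
  "saving w f m h b = (if h = m then w m b else pos_part (w m b - f m h b))"

definition holders :: "nat \<Rightarrow> (nat \<Rightarrow> 'b set) \<Rightarrow> 'b \<Rightarrow> nat set" where
  "holders M T b = {h \<in> {1..M}. b \<in> T h}"

text \<open>Placements \<open>(T\<^sub>1, \<dots>, T\<^sub>M)\<close> are functions on worker indices; values outside
  \<open>{1..M}\<close> play no role.\<close>

definition F_pair ::
  "nat \<Rightarrow> 'b set \<Rightarrow> (nat \<Rightarrow> 'b \<Rightarrow> real) \<Rightarrow> (nat \<Rightarrow> 'b \<Rightarrow> real) \<Rightarrow> (nat \<Rightarrow> nat \<Rightarrow> 'b \<Rightarrow> real)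
    \<Rightarrow> (nat \<Rightarrow> 'b set) \<Rightarrow> real" where
  "F_pair M V \<Lambda> w f T =
     (\<Sum>b\<in>V. \<Sum>m=1..M. \<Lambda> m b * max_or_0 ((\<lambda>h. saving w f m h b) ` holders M T b))"

definition placement_of :: "(nat \<times> 'b) set \<Rightarrow> nat \<Rightarrow> 'b set" where
  "placement_of S m = {b. (m, b) \<in> S}"

definition F_pair_set ::
  "nat \<Rightarrow> 'b set \<Rightarrow> (nat \<Rightarrow> 'b \<Rightarrow> real) \<Rightarrow> (nat \<Rightarrow> 'b \<Rightarrow> real) \<Rightarrow> (nat \<Rightarrow> nat \<Rightarrow> 'b \<Rightarrow> real)
    \<Rightarrow> (nat \<times> 'b) set \<Rightarrow> real" where
  "F_pair_set M V \<Lambda> w f S = F_pair M V \<Lambda> w f (placement_of S)"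

definition submodular_on :: "'e set \<Rightarrow> ('e set \<Rightarrow> real) \<Rightarrow> bool" where
  "submodular_on E F \<longleftrightarrow>
     (\<forall>A B e. A \<subseteq> B \<longrightarrow> B \<subseteq> E \<longrightarrow> e \<in> E - B \<longrightarrow>
        F (A \<union> {e}) - F A \<ge> F (B \<union> {e}) - F B)"

definition marginal_gain ::
  "nat \<Rightarrow> 'b set \<Rightarrow> (nat \<Rightarrow> 'b \<Rightarrow> real) \<Rightarrow> (nat \<Rightarrow> 'b \<Rightarrow> real) \<Rightarrow> (nat \<Rightarrow> nat \<Rightarrow> 'b \<Rightarrow> real)
    \<Rightarrow> (nat \<Rightarrow> 'b set) \<Rightarrow> nat \<Rightarrow> 'b set \<Rightarrow> real" where
  "marginal_gain M V \<Lambda> w f T h X =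
     F_pair M V \<Lambda> w f (T(h := X)) - F_pair M V \<Lambda> w f (T(h := {}))"

definition best_other ::
  "nat \<Rightarrow> (nat \<Rightarrow> 'b \<Rightarrow> real) \<Rightarrow> (nat \<Rightarrow> nat \<Rightarrow> 'b \<Rightarrow> real)
    \<Rightarrow> (nat \<Rightarrow> 'b set) \<Rightarrow> nat \<Rightarrow> nat \<Rightarrow> 'b \<Rightarrow> real" where
  "best_other M w f T h m b =
     max_or_0 {saving w f m l b | l. l \<in> {1..M} \<and> l \<noteq> h \<and> b \<in> T l}"

definition node_profit ::
  "nat \<Rightarrow> (nat \<Rightarrow> 'b \<Rightarrow> real) \<Rightarrow> (nat \<Rightarrow> 'b \<Rightarrow> real) \<Rightarrow> (nat \<Rightarrow> nat \<Rightarrow> 'b \<Rightarrow> real)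
    \<Rightarrow> (nat \<Rightarrow> 'b set) \<Rightarrow> nat \<Rightarrow> 'b \<Rightarrow> real" where
  "node_profit M \<Lambda> w f T h b =
     (\<Sum>m=1..M. \<Lambda> m b * pos_part (saving w f m h b - best_other M w f T h m b))"

end

theory Submission
  imports Defs
begin

text \<open>Since savings are nonnegative, adding a holder with saving \<open>x\<close> to a family whose best saving
  is \<open>v\<close> raises the best saving by \<open>[x - v]\<^sub>+\<close>. Summed over requesters and chunks, this makes the
  gain of placing \<open>X\<close> at worker \<open>h\<close> equal to the sum of the node profits. Submodularity is then the
  observation that a single increment of the set function is a node profit, which decreases
  when the competing placements grow.\<close>

text \<open>With nonnegative members, the default value 0 can count as one more member. This removes
  the case split on emptiness, so facts about \<open>Max\<close> of nonempty sets apply.\<close>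

lemma max_or_0_eq_Max_insert_0:
  assumes "finite A" "\<And>x. x \<in> A \<Longrightarrow> 0 \<le> x"
  shows "max_or_0 A = Max (insert 0 A)"
proof (cases "A = {}")
  case False
  then have "0 \<le> Max A" using assms Max_in by blast
  then show ?thesis using False assms(1) by (simp add: max_or_0_def max_absorb2)
qed (simp add: max_or_0_def)

lemma max_or_0_nonneg:
  assumes "finite A" "\<And>x. x \<in> A \<Longrightarrow> 0 \<le> x"
  shows "0 \<le> max_or_0 A"
  using assms by (simp add: max_or_0_eq_Max_insert_0)

lemma max_or_0_mono:
  assumes "finite B" "A \<subseteq> B" "\<And>x. x \<in> B \<Longrightarrow> 0 \<le> x"
  shows "max_or_0 A \<le> max_or_0 B"
proof -
  \<comment> \<open>\<open>Max_mono\<close> needs a nonempty smaller set; the inserted 0 provides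
    this when \<open>A\<close> is empty.\<close>
  have "Max (insert 0 A) \<le> Max (insert 0 B)"
    using assms(1,2) by (intro Max_mono) auto
  then show ?thesis
    using assms finite_subset[of A B] by (subst (1 2) max_or_0_eq_Max_insert_0) auto
qed

text \<open>Both sides equal \<open>max x (max_or_0 A)\<close>. For empty \<open>A\<close> this
  rests on \<open>0 \<le> x\<close>: the left side is then \<open>x\<close>, the right side
  \<open>pos_part x\<close>.\<close>

lemma max_or_0_insert:
  assumes "finite A" "\<And>a. a \<in> A \<Longrightarrow> 0 \<le> a" "0 \<le> x"
  shows "max_or_0 (insert x A) = max_or_0 A + pos_part (x - max_or_0 A)"
proof -
  have "max_or_0 (insert x A) = Max (insert x (insert 0 A))"
    using assms by (subst max_or_0_eq_Max_insert_0) (auto simp: insert_commute)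
  also have "\<dots> = max x (max_or_0 A)"
    using assms by (subst max_or_0_eq_Max_insert_0[of A]) (auto intro: Max_insert)
  finally show ?thesis by (simp add: pos_part_def max_def)
qed

text \<open>A remote saving is truncated at 0 whatever the fetch cost, and a local one is the
  recomputation cost.\<close>

lemma saving_nonneg: "0 \<le> w m b \<Longrightarrow> 0 \<le> saving w f m h b"
  by (simp add: saving_def pos_part_def)

lemma finite_holders: "finite (holders M T b)"
  by (simp add: holders_def)

lemma holders_fun_upd:
  assumes "h \<in> {1..M}"
  shows "holders M (T(h := X)) b =
    (if b \<in> X then insert h (holders M (T(h := {})) b) else holders M (T(h := {})) b)"
  using assms by (auto simp: holders_def)

text \<open>The competitors of \<open>h\<close> are exactly the holders left once \<open>h\<close>
  is emptied, which is the baseline of \<open>marginal_gain\<close>.\<close>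

lemma best_other_eq_max_or_0_holders:
  "best_other M w f T h m b =
    max_or_0 ((\<lambda>l. saving w f m l b) ` holders M (T(h := {})) b)"
  unfolding best_other_def holders_def by (rule arg_cong[where f = max_or_0]) (auto split: if_splits)

lemma best_other_mono:
  assumes "0 \<le> w m b" "\<And>l. l \<in> {1..M} - {h} \<Longrightarrow> b \<in> T l \<Longrightarrow> b \<in> T' l"
  shows "best_other M w f T h m b \<le> best_other M w f T' h m b"
  unfolding best_other_def using assms
  by (intro max_or_0_mono) (auto intro: saving_nonneg)

text \<open>Larger competing placements raise the value that \<open>h\<close> has to beat. The
  inclusion is asked only at \<open>b\<close> and at workers other than \<open>h\<close>, the only
  places where the profit reads the placement.\<close>

lemma node_profit_antimono:
  assumes "\<And>m. m \<in> {1..M} \<Longrightarrow> 0 \<le> \<Lambda> m b" "\<And>m. m \<in> {1..M} \<Longrightarrow> 0 \<le> w m b"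
    and "\<And>l. l \<in> {1..M} - {h} \<Longrightarrow> b \<in> T l \<Longrightarrow> b \<in> T' l"
  shows "node_profit M \<Lambda> w f T' h b \<le> node_profit M \<Lambda> w f T h b"
proof -
  have "pos_part (saving w f m h b - best_other M w f T' h m b)
      \<le> pos_part (saving w f m h b - best_other M w f T h m b)" if "m \<in> {1..M}" for m
  proof -
    have "best_other M w f T h m b \<le> best_other M w f T' h m b"
      using assms(2)[OF that] assms(3) by (rule best_other_mono)
    then show ?thesis by (simp add: pos_part_def max_def)
  qed
  then show ?thesis
    unfolding node_profit_def using assms(1) by (intro sum_mono mult_left_mono) auto
qed

text \<open>The holders of \<open>b\<close> depend on \<open>X\<close> only through whether
  \<open>b \<in> X\<close>, so chunks contribute independently. Arbitrary
  \<open>X \<subseteq> V\<close> are allowed because single increments of the set function involve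
  sets that need not be parent-closed.\<close>

lemma marginal_gain_eq_sum_node_profit:
  assumes h: "h \<in> {1..M}" and V: "finite V" "X \<subseteq> V"
    and w: "\<And>m b. m \<in> {1..M} \<Longrightarrow> b \<in> V \<Longrightarrow> 0 \<le> w m b"
  shows "marginal_gain M V \<Lambda> w f T h X = (\<Sum>b\<in>X. node_profit M \<Lambda> w f T h b)"
proof -
  let ?H = "holders M (T(h := {}))"
  have best: "max_or_0 ((\<lambda>l. saving w f m l b) ` holders M (T(h := X)) b)
      = max_or_0 ((\<lambda>l. saving w f m l b) ` ?H b)
        + (if b \<in> X then pos_part (saving w f m h b - best_other M w f T h m b) else 0)"
    if "m \<in> {1..M}" "b \<in> V" for m b
    using w[OF that] saving_nonneg[of w m b f]
    by (auto simp: holders_fun_upd[OF h, of T X] best_other_eq_max_or_0_holders finite_holders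
        intro!: max_or_0_insert)
  \<comment> \<open>Each summand splits into its value with \<open>h\<close> emptied and a
    correction present only for chunks in \<open>X\<close>.\<close>
  have "F_pair M V \<Lambda> w f (T(h := X)) = (\<Sum>b\<in>V. \<Sum>m=1..M.
      \<Lambda> m b * max_or_0 ((\<lambda>l. saving w f m l b) ` ?H b)
      + (if b \<in> X then \<Lambda> m b * pos_part (saving w f m h b - best_other M w f T h m b) else 0))"
    unfolding F_pair_def by (intro sum.cong refl) (simp add: best distrib_left)
  also have "\<dots> = F_pair M V \<Lambda> w f (T(h := {}))
      + (\<Sum>b\<in>V. if b \<in> X then node_profit M \<Lambda> w f T h b else 0)"
    unfolding F_pair_def sum.distrib node_profit_def
    by (intro arg_cong2[where f = "(+)"] sum.cong refl) simp
  also have "(\<Sum>b\<in>V. if b \<in> X then node_profit M \<Lambda> w f T h b else 0)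
      = (\<Sum>b\<in>X. node_profit M \<Lambda> w f T h b)"
    using V by (simp add: sum.If_cases Int_absorb1)
  finally show ?thesis unfolding marginal_gain_def by linarith
qed

lemma F_pair_set_increment:
  assumes "(h, b) \<in> {1..M} \<times> V - A" "A \<subseteq> {1..M} \<times> V" "finite V"
    and w: "\<And>m b. m \<in> {1..M} \<Longrightarrow> b \<in> V \<Longrightarrow> 0 \<le> w m b"
  shows "F_pair_set M V \<Lambda> w f (A \<union> {(h, b)}) - F_pair_set M V \<Lambda> w f A
    = node_profit M \<Lambda> w f (placement_of A) h b"
proof -
  let ?T = "placement_of A"
  let ?X = "?T h"
  have X: "?X \<subseteq> V" "b \<notin> ?X" and hb: "h \<in> {1..M}" "b \<in> V"
    using assms(1,2) by (auto simp: placement_of_def)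
  have "placement_of (A \<union> {(h, b)}) = ?T(h := insert b ?X)"
    by (auto simp: placement_of_def fun_eq_iff)
  \<comment> \<open>Both placements are updates of \<open>?T\<close> at \<open>h\<close>, since
    \<open>?T = ?T(h := ?X)\<close>. Their marginal gains share one baseline, which cancels.\<close>
  then have "F_pair_set M V \<Lambda> w f (A \<union> {(h, b)}) - F_pair_set M V \<Lambda> w f A
      = marginal_gain M V \<Lambda> w f ?T h (insert b ?X) - marginal_gain M V \<Lambda> w f ?T h ?X"
    by (simp add: F_pair_set_def marginal_gain_def)
  \<comment> \<open>The two profit sums differ only in the term at \<open>b\<close>, because
    \<open>b \<notin> ?X\<close>.\<close>
  also have "\<dots> = node_profit M \<Lambda> w f ?T h b"
    using X hb \<open>finite V\<close> finite_subset[OF X(1)] w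
    by (subst (1 2) marginal_gain_eq_sum_node_profit) auto
  finally show ?thesis .
qed

lemma F_pair_nonneg:
  assumes "\<And>m b. m \<in> {1..M} \<Longrightarrow> b \<in> V \<Longrightarrow> 0 \<le> \<Lambda> m b"
    and "\<And>m b. m \<in> {1..M} \<Longrightarrow> b \<in> V \<Longrightarrow> 0 \<le> w m b"
  shows "0 \<le> F_pair M V \<Lambda> w f T"
  unfolding F_pair_def using assms
  by (intro sum_nonneg mult_nonneg_nonneg max_or_0_nonneg)
    (auto simp: finite_holders intro: saving_nonneg)

lemma F_pair_mono:
  assumes "\<And>m b. m \<in> {1..M} \<Longrightarrow> b \<in> V \<Longrightarrow> 0 \<le> \<Lambda> m b"
    and "\<And>m b. m \<in> {1..M} \<Longrightarrow> b \<in> V \<Longrightarrow> 0 \<le> w m b"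
    and "\<And>l. l \<in> {1..M} \<Longrightarrow> T l \<subseteq> T' l"
  shows "F_pair M V \<Lambda> w f T \<le> F_pair M V \<Lambda> w f T'"
proof -
  have "holders M T b \<subseteq> holders M T' b" for b
    using assms(3) by (auto simp: holders_def)
  then show ?thesis
    unfolding F_pair_def using assms(1,2)
    by (intro sum_mono mult_left_mono max_or_0_mono image_mono)
      (auto simp: finite_holders intro: saving_nonneg)
qed

text \<open>\<open>is_arg_max\<close> compares objective values at feasible points only, so
  agreement there suffices. This carries the gain formula over to the maximizers.\<close>

lemma is_arg_max_cong:
  assumes "\<And>x. P x \<Longrightarrow> f x = g x"
  shows "is_arg_max f P x \<longleftrightarrow> is_arg_max g P x"
  using assms by (auto simp: is_arg_max_def)

theorem proposition1:
  fixes N V :: "'b set" and r :: 'b and par :: "'b \<Rightarrow> 'b"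
    and M :: nat and k :: "nat \<Rightarrow> nat"
    and \<Lambda> w :: "nat \<Rightarrow> 'b \<Rightarrow> real" and f :: "nat \<Rightarrow> nat \<Rightarrow> 'b \<Rightarrow> real"
  assumes tree: "cacheable_tree N r par V"
    and demand_nonneg: "\<And>m b. m \<in> {1..M} \<Longrightarrow> b \<in> V \<Longrightarrow> \<Lambda> m b \<ge> 0"
    and recomp_nonneg: "\<And>m b. m \<in> {1..M} \<Longrightarrow> b \<in> V \<Longrightarrow> w m b \<ge> 0"
  shows "(\<forall>S \<subseteq> {1..M} \<times> V. F_pair_set M V \<Lambda> w f S \<ge> 0) \<and>
    mono_on (Pow ({1..M} \<times> V)) (F_pair_set M V \<Lambda> w f) \<and>
    submodular_on ({1..M} \<times> V) (F_pair_set M V \<Lambda> w f) \<and>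
    (\<forall>h \<in> {1..M}. \<forall>T. (\<forall>l \<in> {1..M} - {h}. T l \<subseteq> V) \<longrightarrow>
       (\<forall>X. feasible N r par V (k h) X \<longrightarrow>
          marginal_gain M V \<Lambda> w f T h X = (\<Sum>b\<in>X. node_profit M \<Lambda> w f T h b)) \<and>
       (\<forall>X. is_arg_max (marginal_gain M V \<Lambda> w f T h) (feasible N r par V (k h)) X \<longleftrightarrow>
          is_arg_max (\<lambda>Y. \<Sum>b\<in>Y. node_profit M \<Lambda> w f T h b) (feasible N r par V (k h)) X))"
proof (intro conjI ballI allI impI)
  have V: "finite V" using tree by (simp add: cacheable_tree_def)
  let ?F = "F_pair_set M V \<Lambda> w f"
  show "0 \<le> ?F S" for S
    unfolding F_pair_set_def using demand_nonneg recomp_nonneg by (rule F_pair_nonneg)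
  show "mono_on (Pow ({1..M} \<times> V)) ?F"
    unfolding F_pair_set_def using demand_nonneg recomp_nonneg
    by (intro mono_onI F_pair_mono) (auto simp: placement_of_def)
  show "submodular_on ({1..M} \<times> V) ?F"
    unfolding submodular_on_def
  proof (intro allI impI)
    fix A B :: "(nat \<times> 'b) set" and e
    assume AB: "A \<subseteq> B" "B \<subseteq> {1..M} \<times> V" and e: "e \<in> {1..M} \<times> V - B"
    obtain h b where [simp]: "e = (h, b)" by force
    \<comment> \<open>This is the diminishing-returns inequality: the two profits are the increments
      of \<open>?F\<close> at \<open>B\<close> and at \<open>A\<close>, where \<open>e\<close> lies
      outside \<open>A\<close> because \<open>A \<subseteq> B\<close>.\<close>
    have "node_profit M \<Lambda> w f (placement_of B) h b \<le> node_profit M \<Lambda> w f (placement_of A) h b"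
      using AB e demand_nonneg recomp_nonneg
      by (intro node_profit_antimono) (auto simp: placement_of_def)
    moreover have "?F (B \<union> {e}) - ?F B = node_profit M \<Lambda> w f (placement_of B) h b"
      using AB e V recomp_nonneg by (simp only: \<open>e = (h, b)\<close>) (rule F_pair_set_increment, auto)
    moreover have "?F (A \<union> {e}) - ?F A = node_profit M \<Lambda> w f (placement_of A) h b"
      using AB e V recomp_nonneg by (simp only: \<open>e = (h, b)\<close>) (rule F_pair_set_increment, auto)
    ultimately show "?F (B \<union> {e}) - ?F B \<le> ?F (A \<union> {e}) - ?F A" by simp
  qed
  fix h T
  assume h: "h \<in> {1..M}"
  show gain: "marginal_gain M V \<Lambda> w f T h X = (\<Sum>b\<in>X. node_profit M \<Lambda> w f T h b)"
    if "feasible N r par V (k h) X" for X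
    using that h V recomp_nonneg
    by (intro marginal_gain_eq_sum_node_profit) (auto simp: feasible_def parent_closed_def)
  show "is_arg_max (marginal_gain M V \<Lambda> w f T h) (feasible N r par V (k h)) X \<longleftrightarrow>
      is_arg_max (\<lambda>Y. \<Sum>b\<in>Y. node_profit M \<Lambda> w f T h b) (feasible N r par V (k h)) X" for X
    using gain by (rule is_arg_max_cong)
qed

end
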